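(* Let $n$ be a positive integer. For every integer $t>2$, $$SG(n,t,1)=SG^{\neg v,\neg n}(n,t,1)+2\sum_{i=1}^{n-2} SG^{\neg v,\neg n}(n-i,t-1,1)+\sum_{i=2}^{n-2}(i-1)\cdot SG^{\neg v,\neg n}(n-i,t-2,1).$$ For $t=2$, $$SG(n,2,1)=SG^{\neg v,\neg n}(n,2,1)+2\sum_{i=1}^{n-2} SG^{\neg v,\neg n}(n-i,1,1)+n-1.$$ (Empty sums are $0$.)
   Context: A simple game is a pair $(N,v)$ with $N$ a finite nonempty set of players and $v:2^N\to\{0,1\}$ satisfying $v(\emptyset)=0$, $v(N)=1$ and $v(S)\le v(T)$ whenever $S\subseteq T$. A coalition $S$ is winning if $v(S)=1$ and losing otherwise; it is minimal winning if it is winning and all its proper subsets are losing. Two simple games are isomorphic if there is a bijection of the player sets such that a coalition is winning iff its image is winning. Players $a,b$ are equivalent (equi-desirable) if the transposition of $a$ and $b$ preserves the set of winning coalitions; let $N_1,\dots,N_t$ be the equivalence classes and $n_i=|N_i|$. To a coalition $S$ associate the vector $(|S\cap N_1|,\dots,|S\cap N_t|)$; coalitions with the same vector have the same value under $v$. The vectors of minimal winning coalitions are called minimal winning vectors. A simple game with minimum is a simple game with exactly one minimal winning vector $(m_1,\dots,m_t)$; then $S$ is winning iff $|S\cap N_i|\ge m_i$ for all $i$. A player is null if it belongs to no minimal winning coalition, and veto if it belongs to every winning coalition. $SG(n,t,1)$ denotes the number of isomorphism classes of simple games with $n$ players, exactly $t$ equivalence classes of players and exactly one minimal winning vector. $SG^{\neg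 v,\neg n}(n,t,1)$ denotes the number of those isomorphism classes whose games contain neither null nor veto players. *)

theory Defs
  imports "HOL-Combinatorics.Transposition" "HOL-Library.FuncSet"
begin

text \<open>A game is a player set \<open>N\<close> with a function \<open>v\<close>. The function is total on \<open>'a set\<close>,
  but only its values on subsets of \<open>N\<close> are ever used.\<close>

definition simple_game :: "'a set \<Rightarrow> ('a set \<Rightarrow> nat) \<Rightarrow> bool" where
  "simple_game N v \<longleftrightarrow>
     finite N \<and> N \<noteq> {} \<and> (\<forall>S\<subseteq>N. v S \<in> {0, 1}) \<and> v {} = 0 \<and> v N = 1 \<and>
     (\<forall>S T. S \<subseteq> T \<and> T \<subseteq> N \<longrightarrow> v S \<le> v T)"

definition winning :: "'a set \<Rightarrow> ('a set \<Rightarrow> nat) \<Rightarrow> 'a set \<Rightarrow> bool" where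
  "winning N v S \<longleftrightarrow> S \<subseteq> N \<and> v S = 1"

definition minimal_winning :: "'a set \<Rightarrow> ('a set \<Rightarrow> nat) \<Rightarrow> 'a set \<Rightarrow> bool" where
  "minimal_winning N v S \<longleftrightarrow> winning N v S \<and> (\<forall>T. T \<subset> S \<longrightarrow> \<not> winning N v T)"

definition isomorphic_games ::
  "'a set \<Rightarrow> ('a set \<Rightarrow> nat) \<Rightarrow> 'b set \<Rightarrow> ('b set \<Rightarrow> nat) \<Rightarrow> bool" where
  "isomorphic_games N v N' v' \<longleftrightarrow>
     (\<exists>f. bij_betw f N N' \<and> (\<forall>S\<subseteq>N. winning N v S \<longleftrightarrow> winning N' v' (f ` S)))"

definition equivalent_players :: "'a set \<Rightarrow> ('a set \<Rightarrow> nat) \<Rightarrow> ('a \<times> 'a) set" where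
  "equivalent_players N v =
     {(a, b). a \<in> N \<and> b \<in> N \<and>
        (\<forall>S\<subseteq>N. winning N v (transpose a b ` S) \<longleftrightarrow> winning N v S)}"

definition player_classes :: "'a set \<Rightarrow> ('a set \<Rightarrow> nat) \<Rightarrow> 'a set set" where
  "player_classes N v = N // equivalent_players N v"

text \<open>Vectors are indexed by the equivalence classes themselves instead of by a numbering
  \<open>N\<^sub>1, \<dots>, N\<^sub>t\<close> of them.\<close>

definition coalition_vector ::
  "'a set \<Rightarrow> ('a set \<Rightarrow> nat) \<Rightarrow> 'a set \<Rightarrow> ('a set \<Rightarrow> nat)" where
  "coalition_vector N v S = (\<lambda>C\<in>player_classes N v. card (S \<inter> C))"

definition minimal_winning_vectors :: "'a set \<Rightarrow> ('a set \<Rightarrow> nat) \<Rightarrow> ('a set \<Rightarrow> nat) set" where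
  "minimal_winning_vectors N v = coalition_vector N v ` {S. minimal_winning N v S}"

definition null_player :: "'a set \<Rightarrow> ('a set \<Rightarrow> nat) \<Rightarrow> 'a \<Rightarrow> bool" where
  "null_player N v a \<longleftrightarrow> a \<in> N \<and> (\<forall>S. minimal_winning N v S \<longrightarrow> a \<notin> S)"

definition veto_player :: "'a set \<Rightarrow> ('a set \<Rightarrow> nat) \<Rightarrow> 'a \<Rightarrow> bool" where
  "veto_player N v a \<longleftrightarrow> a \<in> N \<and> (\<forall>S. winning N v S \<longrightarrow> a \<in> S)"

text \<open>Every finite game is isomorphic to one whose players are natural numbers, so isomorphism
  classes are counted among the games with \<open>N :: nat set\<close>.\<close>

definition game_iso :: "((nat set \<times> (nat set \<Rightarrow> nat)) \<times> (nat set \<times> (nat set \<Rightarrow> nat))) set" where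
  "game_iso = {((N, v), (N', v')).
     simple_game N v \<and> simple_game N' v' \<and> isomorphic_games N v N' v'}"

definition games :: "nat \<Rightarrow> nat \<Rightarrow> nat \<Rightarrow> (nat set \<times> (nat set \<Rightarrow> nat)) set" where
  "games n t r = {(N, v). simple_game N v \<and> card N = n \<and>
     card (player_classes N v) = t \<and> card (minimal_winning_vectors N v) = r}"

definition SG :: "nat \<Rightarrow> nat \<Rightarrow> nat \<Rightarrow> nat" where
  "SG n t r = card (games n t r // game_iso)"

definition SG_no_veto_no_null :: "nat \<Rightarrow> nat \<Rightarrow> nat \<Rightarrow> nat" where
  "SG_no_veto_no_null n t r =
     card ({(N, v) \<in> games n t r. \<forall>a\<in>N. \<not> veto_player N v a \<and> \<not> null_player N v a} // game_iso)"

end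

theory Submission
  imports Defs "HOL-Library.Multiset" "HOL-Library.Disjoint_Sets"
begin

text \<open>A game with a single minimal winning vector \<open>m\<close> is determined by its quotas: a coalition wins
  iff it contains at least \<open>m C\<close> players of every equivalence class \<open>C\<close>. Up to isomorphism only the
  multiset of the pairs \<open>(|C|, m C)\<close> matters, called the profile of the game below
  (\<open>isomorphic_imp_profile_eq\<close>, \<open>profile_eq_imp_isomorphic\<close>). So the games can be counted by counting
  the profiles that occur.

  Which profiles occur is decided by \<open>equivalent_iff\<close>: if quotas are imposed on the blocks of an
  arbitrary partition, then two players of different blocks are equivalent exactly if both blocks
  have quota \<open>0\<close> (null players) or both have their full size as quota (veto players). The blocks are
  therefore the equivalence classes iff there is at most one null block and at most one veto block.
  Beyond that only \<open>v {} = 0\<close> is a restriction: some quota has to be positive.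

  The games without null and veto players are those whose profile consists of pairs with quota
  strictly between \<open>0\<close> and the size. Any other profile arises from such a strict one in a unique way
  by adjoining a null pair \<open>(i, 0)\<close>, a veto pair \<open>(i, i)\<close>, or both (\<open>profiles_eq_adjoin\<close>). The first two
  cases give the doubled sum of the recurrence; in the third, a total of \<open>i\<close> null and veto players
  can be split in \<open>i - 1\<close> ways. A nonempty strict profile accounts for at least two players, which
  explains the upper limit \<open>n - 2\<close>; for \<open>t = 2\<close> the strict part of the third case is empty, all \<open>n\<close>
  players are null or veto players, and the last sum becomes \<open>n - 1\<close>.\<close>

section \<open>Coalitions with equal vectors\<close>

lemma transpose_image_subset:
  assumes "a \<in> N" "b \<in> N" "S \<subseteq> N"
  shows "transpose a b ` S \<subseteq> N"
  using assms by (auto simp: transpose_def)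

lemma equivalent_players_equiv: "equiv N (equivalent_players N v)"
proof (rule equivI)
  show "equivalent_players N v \<subseteq> N \<times> N" "refl_on N (equivalent_players N v)"
    "sym (equivalent_players N v)"
    by (auto simp: equivalent_players_def refl_on_def sym_def transpose_commute)
  show "trans (equivalent_players N v)"
  proof (rule transI)
    fix a b c
    assume ab: "(a, b) \<in> equivalent_players N v" and bc: "(b, c) \<in> equivalent_players N v"
    show "(a, c) \<in> equivalent_players N v"
    proof (cases "a = c \<or> b = c")
      case True
      then show ?thesis using ab by (auto simp: equivalent_players_def)
    next
      case False
      have "winning N v (transpose a c ` S) \<longleftrightarrow> winning N v S" if "S \<subseteq> N" for S
      proof -
        let ?ab = "\<lambda>S. transpose a b ` S" and ?bc = "\<lambda>S. transpose b c ` S"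
        have sub: "?ab S \<subseteq> N" "?bc (?ab S) \<subseteq> N"
          using that ab bc by (auto simp: equivalent_players_def intro!: transpose_image_subset
              del: subsetI)
        have "transpose a c ` S = ?ab (?bc (?ab S))"
          \<comment> \<open>A transposition of \<open>a\<close> and \<open>c\<close> is that of \<open>b\<close> and \<open>c\<close> conjugated by that of \<open>a\<close> and \<open>b\<close>.\<close>
          using False by (simp flip: transpose_comp_triple[of a c b] add: image_comp o_assoc)
        then show ?thesis
          using sub that ab bc by (simp add: equivalent_players_def)
      qed
      then show ?thesis using ab bc by (auto simp: equivalent_players_def)
    qed
  qed
qed

lemma player_classes_partition: "partition_on N (player_classes N v)"
  unfolding player_classes_def by (rule partition_on_quotient[OF equivalent_players_equiv])

lemma same_class_equivalent:
  assumes "C \<in> player_classes N v" "a \<in> C" "b \<in> C"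
  shows "(a, b) \<in> equivalent_players N v"
  using assms equivalent_players_equiv unfolding player_classes_def
  by (metis in_quotient_imp_in_rel insert_subset empty_subsetI)

lemma partition_subset_eqI:
  assumes "partition_on N P" "S \<subseteq> N" "T \<subseteq> N" "\<And>C. C \<in> P \<Longrightarrow> S \<inter> C = T \<inter> C"
  shows "S = T"
proof -
  have "S = (\<Union>C\<in>P. S \<inter> C)" "T = (\<Union>C\<in>P. T \<inter> C)"
    using assms(1-3) by (auto simp: partition_on_def)
  then show ?thesis using assms(4) by simp
qed

text \<open>Exchanging a player of \<open>S - T\<close> for an equivalent player of \<open>T - S\<close> preserves both the vector and
  the value of \<open>S\<close> and brings \<open>S\<close> closer to \<open>T\<close>; since the vectors agree, such a pair exists as long as
  \<open>S\<close> and \<open>T\<close> differ.\<close>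

lemma equal_vector_winning_iff:
  assumes "finite N" "S \<subseteq> N" "T \<subseteq> N"
    and "\<And>C. C \<in> player_classes N v \<Longrightarrow> card (S \<inter> C) = card (T \<inter> C)"
  shows "winning N v S \<longleftrightarrow> winning N v T"
  using assms(2,4)
proof (induction "card (S - T)" arbitrary: S rule: less_induct)
  case less
  note part = player_classes_partition[of N v]
  have finS: "finite S" and finT: "finite T"
    using finite_subset[OF _ assms(1)] less.prems(1) assms(3) by blast+
  show ?case
  proof (cases "S \<subseteq> T")
    case True
    have "S = T"
    proof (rule partition_subset_eqI[OF part])
      fix C assume "C \<in> player_classes N v"
      then show "S \<inter> C = T \<inter> C"
        using True less.prems(2) finT by (intro card_subset_eq) auto
    qed (use less.prems assms in auto)
    then show ?thesis by simp
  next
    case False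
    then obtain a where a: "a \<in> S" "a \<notin> T" by auto
    obtain C where C: "C \<in> player_classes N v" "a \<in> C"
      using a less.prems(1) part by (auto simp: partition_on_def)
    have "\<not> T \<inter> C \<subseteq> S \<inter> C"
    proof
      assume "T \<inter> C \<subseteq> S \<inter> C"
      then have "T \<inter> C = S \<inter> C"
        using less.prems(2)[OF C(1)] finS by (intro card_subset_eq) auto
      then show False using a C by auto
    qed
    then obtain b where b: "b \<in> T" "b \<in> C" "b \<notin> S" by auto
    have ab: "(a, b) \<in> equivalent_players N v" using same_class_equivalent C b by metis
    define S' where "S' = transpose a b ` S"
    have S': "S' = insert b (S - {a})"
      using a b by (auto simp: S'_def in_transpose_image_iff transpose_def split: if_splits)
    have "S' - T = (S - T) - {a}" using S' b by auto
    then have "card (S' - T) < card (S - T)"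
      using a finS by (simp add: card_Diff1_less del: card_Diff_insert)
    moreover have "S' \<subseteq> N" using S' less.prems(1) b assms(3) by auto
    moreover have "card (S' \<inter> D) = card (T \<inter> D)" if D: "D \<in> player_classes N v" for D
    proof (cases "D = C")
      case True
      have "S' \<inter> C = transpose a b ` (S \<inter> C)"
        using C b by (auto simp: S'_def in_transpose_image_iff transpose_def split: if_splits)
      then show ?thesis using less.prems(2)[OF D] True by (simp add: card_image)
    next
      case False
      then have "D \<inter> C = {}" using part D C by (auto simp: partition_on_def disjoint_def)
      then have "S' \<inter> D = S \<inter> D" using C b S' by auto
      then show ?thesis using less.prems(2)[OF D] by simp
    qed
    ultimately have "winning N v S' \<longleftrightarrow> winning N v T" by (rule less.hyps)
    moreover have "winning N v S' \<longleftrightarrow> winning N v S"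
      using ab less.prems(1) by (simp add: equivalent_players_def S'_def)
    ultimately show ?thesis by simp
  qed
qed

lemma partition_block_unique:
  "partition_on N P \<Longrightarrow> C \<in> P \<Longrightarrow> D \<in> P \<Longrightarrow> a \<in> C \<Longrightarrow> a \<in> D \<Longrightarrow> C = D"
  by (auto simp: partition_on_def disjoint_def)

lemma coalition_with_counts:
  assumes part: "partition_on N P" and le: "\<And>C. C \<in> P \<Longrightarrow> k C \<le> card (S \<inter> C)"
  obtains T where "T \<subseteq> S" "\<And>C. C \<in> P \<Longrightarrow> card (T \<inter> C) = k C"
proof -
  have "\<forall>C\<in>P. \<exists>X. X \<subseteq> S \<inter> C \<and> card X = k C"
    using le by (meson obtain_subset_with_card_n)
  then obtain X where X: "\<And>C. C \<in> P \<Longrightarrow> X C \<subseteq> S \<inter> C \<and> card (X C) = k C" by metis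
  have "(\<Union>C\<in>P. X C) \<inter> D = X D" if "D \<in> P" for D
    using X that partition_block_unique[OF part] by blast
  moreover have "(\<Union>C\<in>P. X C) \<subseteq> S" using X by blast
  ultimately show thesis using that[of "\<Union>C\<in>P. X C"] X by simp
qed

lemma winning_superset:
  assumes "simple_game N v" "winning N v S" "S \<subseteq> T" "T \<subseteq> N"
  shows "winning N v T"
proof -
  have "v S \<le> v T" "v T \<in> {0, 1}" "v S = 1"
    using assms unfolding simple_game_def winning_def by blast+
  then show ?thesis using assms(4) by (auto simp: winning_def)
qed

lemma contains_minimal_winning:
  assumes "finite N" "winning N v S"
  obtains T where "minimal_winning N v T" "T \<subseteq> S"
proof -
  let ?W = "{T. T \<subseteq> S \<and> winning N v T}"
  have "finite ?W" using assms by (auto simp: winning_def intro: finite_subset[of _ "Pow N"])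
  then obtain T where "T \<in> ?W" "\<forall>U\<in>?W. U \<subseteq> T \<longrightarrow> T = U"
    using finite_has_minimal2[of ?W S] assms by auto
  then show thesis using that[of T] by (auto simp: minimal_winning_def)
qed

section \<open>Games given by quotas on a partition\<close>

text \<open>The partition \<open>P\<close> is any partition, not only that into equivalence classes. This pays off twice: the
  classes of a game built from given quotas can be computed, and the quotas of a game can be moved
  along an isomorphism before it is known that isomorphisms preserve classes.\<close>

locale quota_game =
  fixes N :: "'a set" and v :: "'a set \<Rightarrow> nat" and P :: "'a set set" and m :: "'a set \<Rightarrow> nat"
  assumes game: "simple_game N v"
    and part: "partition_on N P"
    and quota_le: "C \<in> P \<Longrightarrow> m C \<le> card C"
    and winning_iff: "S \<subseteq> N \<Longrightarrow> winning N v S \<longleftrightarrow> (\<forall>C\<in>P. m C \<le> card (S \<inter> C))"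
begin

lemma finite_players: "finite N"
  using game by (simp add: simple_game_def)

lemma block_subset: "C \<in> P \<Longrightarrow> C \<subseteq> N"
  using part by (auto simp: partition_on_def)

lemma finite_block: "C \<in> P \<Longrightarrow> finite C"
  using block_subset finite_players finite_subset by blast

lemma finite_partition: "finite P"
  using finite_elements[OF finite_players part] .

lemma disjoint_blocks: "C \<in> P \<Longrightarrow> D \<in> P \<Longrightarrow> C \<noteq> D \<Longrightarrow> C \<inter> D = {}"
  using part by (auto simp: partition_on_def disjoint_def)

lemma block_unique: "C \<in> P \<Longrightarrow> D \<in> P \<Longrightarrow> a \<in> C \<Longrightarrow> a \<in> D \<Longrightarrow> C = D"
  by (rule partition_block_unique[OF part])

lemma block_of:
  assumes "a \<in> N" obtains C where "C \<in> P" "a \<in> C"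
  using assms part by (auto simp: partition_on_def)

lemma card_block_pos: "C \<in> P \<Longrightarrow> 0 < card C"
  using part finite_block by (auto simp: partition_on_def card_gt_0_iff)

lemma some_positive_quota: "\<exists>C\<in>P. 0 < m C"
proof (rule ccontr)
  assume "\<not> ?thesis"
  then have "winning N v {}" using winning_iff by auto
  then show False using game by (auto simp: winning_def simple_game_def)
qed

lemma minimal_winning_iff:
  "minimal_winning N v S \<longleftrightarrow> S \<subseteq> N \<and> (\<forall>C\<in>P. card (S \<inter> C) = m C)"
proof
  assume min: "minimal_winning N v S"
  then have S: "S \<subseteq> N" "winning N v S" by (auto simp: minimal_winning_def winning_def)
  then obtain T where T: "T \<subseteq> S" "\<And>C. C \<in> P \<Longrightarrow> card (T \<inter> C) = m C"
    using winning_iff coalition_with_counts[OF part, of m S] by metis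
  then have "winning N v T" using winning_iff S by auto
  then have "T = S" using min T by (auto simp: minimal_winning_def)
  then show "S \<subseteq> N \<and> (\<forall>C\<in>P. card (S \<inter> C) = m C)" using S T by auto
next
  assume S: "S \<subseteq> N \<and> (\<forall>C\<in>P. card (S \<inter> C) = m C)"
  have "\<not> winning N v T" if T: "T \<subset> S" for T
  proof
    assume "winning N v T"
    then have le: "m C \<le> card (T \<inter> C)" if "C \<in> P" for C
      using winning_iff S T that by (metis psubset_imp_subset subset_trans)
    have "T = S"
    proof (rule partition_subset_eqI[OF part])
      fix C assume C: "C \<in> P"
      then show "T \<inter> C = S \<inter> C"
        using le[OF C] S T finite_block[OF C] by (intro card_seteq) auto
    qed (use S T in auto)
    then show False using T by simp
  qed
  then show "minimal_winning N v S" using S winning_iff by (auto simp: minimal_winning_def)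
qed

lemma minimal_winning_with:
  assumes "a \<in> C" "C \<in> P" "0 < m C"
  obtains S where "minimal_winning N v S" "a \<in> S"
proof -
  obtain T where T: "T \<subseteq> N" "\<And>D. D \<in> P \<Longrightarrow> card (T \<inter> D) = m D"
    using coalition_with_counts[OF part, of m N] quota_le block_subset
    by (metis inf.absorb2 order_refl)
  obtain X where X: "X \<subseteq> C - {a}" "card X = m C - 1"
    using obtain_subset_with_card_n[of "m C - 1" "C - {a}"] quota_le[OF assms(2)] assms
    by (metis card_Diff_singleton diff_le_mono)
  have finX: "finite X" using X finite_block assms(2) finite_subset by blast
  let ?S = "(T - C) \<union> insert a X"
  have "card (?S \<inter> D) = m D" if D: "D \<in> P" for D
  proof (cases "D = C")
    case True
    then have "?S \<inter> D = insert a X" using X assms by auto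
    moreover have "a \<notin> X" using X by auto
    ultimately show ?thesis using X(2) assms True finX by simp
  next
    case False
    then have "?S \<inter> D = T \<inter> D" using disjoint_blocks[OF D assms(2)] X assms by auto
    then show ?thesis using T D by simp
  qed
  moreover have "?S \<subseteq> N" using T X assms block_subset by blast
  ultimately show thesis using that[of ?S] minimal_winning_iff by auto
qed

lemma null_player_iff:
  assumes "C \<in> P" "a \<in> C"
  shows "null_player N v a \<longleftrightarrow> m C = 0"
proof
  assume "null_player N v a"
  then show "m C = 0"
    using minimal_winning_with[OF assms(2,1)] by (auto simp: null_player_def)
next
  assume "m C = 0"
  then have "a \<notin> S" if "minimal_winning N v S" for S
  proof -
    have "card (S \<inter> C) = 0" using that assms(1) \<open>m C = 0\<close> minimal_winning_iff by simp
    then show ?thesis using assms finite_block[OF assms(1)] by auto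
  qed
  then show "null_player N v a" using assms block_subset by (auto simp: null_player_def)
qed

text \<open>If the quota of \<open>C\<close> is below its size, the grand coalition still wins without \<open>a\<close>.\<close>

lemma veto_player_iff:
  assumes "C \<in> P" "a \<in> C"
  shows "veto_player N v a \<longleftrightarrow> m C = card C"
proof
  assume veto: "veto_player N v a"
  show "m C = card C"
  proof (rule ccontr)
    assume "m C \<noteq> card C"
    then have lt: "m C < card C" using quota_le[OF assms(1)] by simp
    have "m D \<le> card ((N - {a}) \<inter> D)" if D: "D \<in> P" for D
    proof (cases "D = C")
      case True
      then have "(N - {a}) \<inter> D = C - {a}" using block_subset[OF assms(1)] by auto
      then show ?thesis using lt assms True by simp
    next
      case False
      then have "(N - {a}) \<inter> D = D"
        using block_subset[OF D] disjoint_blocks[OF D assms(1)] assms by auto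
      then show ?thesis using quota_le[OF D] by simp
    qed
    then have "winning N v (N - {a})" using winning_iff[of "N - {a}"] by auto
    then show False using veto by (auto simp: veto_player_def)
  qed
next
  assume eq: "m C = card C"
  have "a \<in> S" if "winning N v S" for S
  proof -
    have "card C \<le> card (S \<inter> C)"
      using that eq winning_iff assms by (metis winning_def)
    then have "S \<inter> C = C" using finite_block[OF assms(1)] by (intro card_seteq) auto
    then show ?thesis using assms by auto
  qed
  then show "veto_player N v a" using assms block_subset by (auto simp: veto_player_def)
qed

lemma transpose_block:
  assumes "D \<in> P" "a \<in> D \<longleftrightarrow> b \<in> D"
  shows "card (transpose a b ` S \<inter> D) = card (S \<inter> D)"
proof -
  have "transpose a b ` S \<inter> D = transpose a b ` (S \<inter> D)"
    using assms(2) by (auto simp: in_transpose_image_iff transpose_def split: if_splits)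
  then show ?thesis by (simp add: card_image)
qed

text \<open>The separating coalition \<open>?T\<close> meets the quota of \<open>C\<close> exactly, with the help of \<open>a\<close>, and contains all
  of \<open>D\<close> but \<open>b\<close>. It wins, and replacing \<open>a\<close> by \<open>b\<close> makes it fall short in \<open>C\<close>.\<close>

lemma not_equivalentI:
  assumes C: "C \<in> P" "a \<in> C" and D: "D \<in> P" "b \<in> D" and "C \<noteq> D" and q: "0 < m C" "m D < card D"
  shows "(a, b) \<notin> equivalent_players N v"
proof
  assume "(a, b) \<in> equivalent_players N v"
  then have eq: "\<And>S. S \<subseteq> N \<Longrightarrow> winning N v (transpose a b ` S) \<longleftrightarrow> winning N v S"
    by (auto simp: equivalent_players_def)
  obtain S where S: "minimal_winning N v S" "a \<in> S"
    using minimal_winning_with C q by metis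
  have disj: "C \<inter> D = {}" using disjoint_blocks C D \<open>C \<noteq> D\<close> by blast
  let ?T = "(S - D) \<union> (D - {b})"
  have TN: "?T \<subseteq> N" using S block_subset D minimal_winning_iff by blast
  have "m E \<le> card (?T \<inter> E)" if E: "E \<in> P" for E
  proof (cases "E = D")
    case True
    then have "?T \<inter> E = D - {b}" by auto
    then show ?thesis using True q D finite_block by simp
  next
    case False
    then have "?T \<inter> E = S \<inter> E" using disjoint_blocks[OF E D(1)] by auto
    then show ?thesis using S E minimal_winning_iff by auto
  qed
  then have "winning N v ?T" using winning_iff TN by auto
  then have win: "winning N v (transpose a b ` ?T)" using eq TN by auto
  then have "m C \<le> card (transpose a b ` ?T \<inter> C)" using winning_iff C by (metis winning_def)
  also have "transpose a b ` ?T \<inter> C \<subseteq> S \<inter> C - {a}"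
    using C D disj by (auto simp: transpose_def split: if_splits)
  then have "card (transpose a b ` ?T \<inter> C) \<le> card (S \<inter> C - {a})"
    using finite_block C by (intro card_mono) auto
  also have "\<dots> < card (S \<inter> C)"
    using C S finite_block by (intro card_Diff1_less) auto
  also have "\<dots> = m C" using S C minimal_winning_iff by auto
  finally show False by simp
qed

text \<open>Unless two different blocks are both null or both veto, one of the two orders of the blocks satisfies the
  hypotheses of the preceding lemma. Conversely, null players do not influence any winning
  condition, veto players belong to every coalition that is winning before or after the exchange,
  and an exchange within a block changes no counts.\<close>

lemma equivalent_iff:
  assumes C: "C \<in> P" "a \<in> C" and D: "D \<in> P" "b \<in> D"
  shows "(a, b) \<in> equivalent_players N v \<longleftrightarrow>
    C = D \<or> m C = 0 \<and> m D = 0 \<or> m C = card C \<and> m D = card D"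
proof
  assume eq: "(a, b) \<in> equivalent_players N v"
  then have eq': "(b, a) \<in> equivalent_players N v"
    using equivalent_players_equiv by (metis equivE symD)
  have "C = D \<or> m C = 0 \<or> card D \<le> m D" "C = D \<or> m D = 0 \<or> card C \<le> m C"
    using not_equivalentI[OF C D] not_equivalentI[OF D C] eq eq' by force+
  then show "C = D \<or> m C = 0 \<and> m D = 0 \<or> m C = card C \<and> m D = card D"
    using quota_le card_block_pos C D by (metis le_antisym le_zero_eq less_irrefl)
next
  assume *: "C = D \<or> m C = 0 \<and> m D = 0 \<or> m C = card C \<and> m D = card D"
  have ab: "a \<in> N" "b \<in> N" using C D block_subset by auto
  show "(a, b) \<in> equivalent_players N v"
  proof (cases "C \<noteq> D \<and> m C = card C \<and> m D = card D")
    case True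
    have veto: "veto_player N v a" "veto_player N v b"
      using True C D veto_player_iff by auto
    have "winning N v (transpose a b ` S) \<longleftrightarrow> winning N v S" if "S \<subseteq> N" for S
    proof -
      have "a \<in> S \<and> b \<in> S" if "winning N v S"
        using that veto by (simp add: veto_player_def)
      moreover have "b \<in> S \<and> a \<in> S" if "winning N v (transpose a b ` S)"
      proof -
        have "a \<in> transpose a b ` S" "b \<in> transpose a b ` S"
          using that veto by (simp_all add: veto_player_def)
        then show ?thesis by (simp add: in_transpose_image_iff)
      qed
      ultimately show ?thesis by (metis transpose_image_eq)
    qed
    then show ?thesis using ab by (auto simp: equivalent_players_def)
  next
    case False
    have "winning N v (transpose a b ` S) \<longleftrightarrow> winning N v S" if "S \<subseteq> N" for S
    proof -
      have "m E \<le> card (transpose a b ` S \<inter> E) \<longleftrightarrow> m E \<le> card (S \<inter> E)" if E: "E \<in> P" for E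
      proof (cases "m E = 0")
        case False
        then have "a \<in> E \<longleftrightarrow> b \<in> E"
          using * \<open>\<not> (C \<noteq> D \<and> _)\<close> block_unique C D E by metis
        then show ?thesis using transpose_block[OF E] by simp
      qed simp
      then show ?thesis
        using winning_iff transpose_image_subset[OF ab] that by simp
    qed
    then show ?thesis using ab by (auto simp: equivalent_players_def)
  qed
qed

end

section \<open>Games with a single minimal winning vector\<close>

text \<open>Expressing the quotas by the winning coalitions alone makes the profile a function of the game;
  \<open>quota_eq\<close> identifies them with the quotas of any reduced presentation.\<close>

definition quota :: "'a set \<Rightarrow> ('a set \<Rightarrow> nat) \<Rightarrow> 'a set \<Rightarrow> nat" where
  "quota N v C = (LEAST k. \<exists>S. winning N v S \<and> card (S \<inter> C) = k)"

definition profile :: "'a set \<Rightarrow> ('a set \<Rightarrow> nat) \<Rightarrow> (nat \<times> nat) multiset" where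
  "profile N v = image_mset (\<lambda>C. (card C, quota N v C)) (mset_set (player_classes N v))"

locale reduced_quota_game = quota_game +
  assumes null_unique: "C \<in> P \<Longrightarrow> D \<in> P \<Longrightarrow> m C = 0 \<Longrightarrow> m D = 0 \<Longrightarrow> C = D"
    and veto_unique: "C \<in> P \<Longrightarrow> D \<in> P \<Longrightarrow> m C = card C \<Longrightarrow> m D = card D \<Longrightarrow> C = D"
begin

lemma player_classes_eq: "player_classes N v = P"
proof -
  have "equivalent_players N v = {(x, y). \<exists>p\<in>P. x \<in> p \<and> y \<in> p}"
  proof (rule set_eqI, clarify)
    fix a b
    show "(a, b) \<in> equivalent_players N v \<longleftrightarrow> (a, b) \<in> {(x, y). \<exists>p\<in>P. x \<in> p \<and> y \<in> p}"
    proof (cases "a \<in> N \<and> b \<in> N")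
      case True
      obtain C where C: "C \<in> P" "a \<in> C" using block_of True by blast
      obtain D where D: "D \<in> P" "b \<in> D" using block_of True by blast
      have "(a, b) \<in> equivalent_players N v \<longleftrightarrow> C = D"
        using equivalent_iff[OF C D] null_unique[OF C(1) D(1)] veto_unique[OF C(1) D(1)] by auto
      also have "\<dots> \<longleftrightarrow> (\<exists>p\<in>P. a \<in> p \<and> b \<in> p)"
        using C D block_unique by blast
      finally show ?thesis by simp
    next
      case False
      then show ?thesis using block_subset by (auto simp: equivalent_players_def)
    qed
  qed
  then show ?thesis
    unfolding player_classes_def by (simp add: partition_on_eq_quotient[OF part])
qed

lemma obtain_minimal_winning:
  obtains S where "minimal_winning N v S"
proof -
  have "m C \<le> card (N \<inter> C)" if "C \<in> P" for C
    using quota_le[OF that] block_subset[OF that] by (simp add: inf.absorb2)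
  then obtain T where "T \<subseteq> N" "\<And>C. C \<in> P \<Longrightarrow> card (T \<inter> C) = m C"
    using coalition_with_counts[OF part, of m N] by blast
  then show thesis using that[of T] minimal_winning_iff by simp
qed

lemma quota_eq:
  assumes "C \<in> P"
  shows "quota N v C = m C"
  unfolding quota_def
proof (rule Least_equality)
  obtain S where "minimal_winning N v S" using obtain_minimal_winning .
  then show "\<exists>S. winning N v S \<and> card (S \<inter> C) = m C"
    using assms minimal_winning_iff minimal_winning_def by metis
next
  fix k assume "\<exists>S. winning N v S \<and> card (S \<inter> C) = k"
  then show "m C \<le> k" using winning_iff assms by (auto simp: winning_def)
qed

lemma profile_eq: "profile N v = image_mset (\<lambda>C. (card C, m C)) (mset_set P)"
  unfolding profile_def player_classes_eq
  by (rule image_mset_cong) (simp add: quota_eq finite_partition)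

lemma one_minimal_winning_vector: "card (minimal_winning_vectors N v) = 1"
proof -
  have "coalition_vector N v S = restrict m P" if "minimal_winning N v S" for S
    using that by (auto simp: coalition_vector_def player_classes_eq minimal_winning_iff)
  then have "minimal_winning_vectors N v = {restrict m P}"
    using obtain_minimal_winning by (auto simp: minimal_winning_vectors_def image_iff)
  then show ?thesis by simp
qed

end

text \<open>A coalition that meets the single vector \<open>m\<close> in every class contains a coalition with vector
  exactly \<open>m\<close>, which wins because a minimal winning coalition has the same vector. The
  presentation is reduced because two null classes, or two veto classes, would be one class by
  \<open>equivalent_iff\<close>.\<close>

lemma one_vector_imp_reduced_quota_game:
  assumes game: "simple_game N v" and one: "card (minimal_winning_vectors N v) = 1"
  obtains m where "reduced_quota_game N v (player_classes N v) m"
proof -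
  have fin: "finite N" using game by (simp add: simple_game_def)
  obtain m where m: "minimal_winning_vectors N v = {m}"
    using one by (rule card_1_singletonE)
  have vec: "card (S \<inter> C) = m C" if "minimal_winning N v S" "C \<in> player_classes N v" for S C
  proof -
    have "coalition_vector N v S = m"
      using m that by (auto simp: minimal_winning_vectors_def)
    then show ?thesis using that by (auto simp: coalition_vector_def)
  qed
  obtain T where T: "minimal_winning N v T"
    using m by (auto simp: minimal_winning_vectors_def)
  have TN: "T \<subseteq> N" "winning N v T" using T by (auto simp: minimal_winning_def winning_def)
  have winI: "winning N v S" if S: "S \<subseteq> N" "\<And>C. C \<in> player_classes N v \<Longrightarrow> m C \<le> card (S \<inter> C)" for S
  proof -
    obtain U where U: "U \<subseteq> S" "\<And>C. C \<in> player_classes N v \<Longrightarrow> card (U \<inter> C) = m C"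
      using coalition_with_counts[OF player_classes_partition S(2)] by blast
    then have "card (U \<inter> D) = card (T \<inter> D)" if "D \<in> player_classes N v" for D
      using vec[OF T] that by simp
    then have "winning N v U"
      using equal_vector_winning_iff[OF fin _ TN(1)] U(1) S(1) TN(2) by (meson subset_trans)
    then show ?thesis using winning_superset game U(1) S(1) by metis
  qed
  interpret quota_game N v "player_classes N v" m
  proof
    fix C assume C: "C \<in> player_classes N v"
    then have "finite C" using player_classes_partition fin
      by (metis Union_upper finite_subset partition_onD1)
    then show "m C \<le> card C" using vec[OF T C] by (metis card_mono inf_le2)
  next
    fix S assume S: "S \<subseteq> N"
    show "winning N v S \<longleftrightarrow> (\<forall>C\<in>player_classes N v. m C \<le> card (S \<inter> C))"
    proof
      assume "winning N v S"
      then obtain U where U: "minimal_winning N v U" "U \<subseteq> S"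
        using contains_minimal_winning fin by metis
      have "finite S" using S fin finite_subset by blast
      then show "\<forall>C\<in>player_classes N v. m C \<le> card (S \<inter> C)"
        using vec[OF U(1)] U by (metis card_mono finite_Int inf_mono order_refl)
    qed (use winI S in auto)
  qed (use game player_classes_partition in auto)
  have class_unique: "C = D"
    if CD: "C \<in> player_classes N v" "D \<in> player_classes N v"
      and "m C = 0 \<and> m D = 0 \<or> m C = card C \<and> m D = card D" for C D
  proof -
    obtain a b where ab: "a \<in> C" "b \<in> D"
      using card_block_pos[OF CD(1)] card_block_pos[OF CD(2)] by (fastforce simp: card_gt_0_iff)
    then have "(a, b) \<in> equivalent_players N v"
      using equivalent_iff[OF CD(1) _ CD(2)] that(3) by blast
    then show ?thesis
      using quotient_eqI[OF equivalent_players_equiv CD[unfolded player_classes_def] ab] by simp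
  qed
  have "reduced_quota_game N v (player_classes N v) m"
    by unfold_locales (use class_unique in auto)
  then show thesis by (rule that)
qed

section \<open>Profiles classify games up to isomorphism\<close>

lemma isomorphic_transfers_quotas:
  assumes "reduced_quota_game N v P m" and game': "simple_game N' v'"
    and f: "bij_betw f N N'" "\<And>S. S \<subseteq> N \<Longrightarrow> winning N v S \<longleftrightarrow> winning N' v' (f ` S)"
  shows "reduced_quota_game N' v' ((`) f ` P) (\<lambda>D. m {x \<in> N. f x \<in> D})"
proof -
  interpret reduced_quota_game N v P m by fact
  have inj: "inj_on f N" and img: "f ` N = N'" using f by (auto simp: bij_betw_def)
  have pre: "{x \<in> N. f x \<in> f ` C} = C" if "C \<subseteq> N" for C
    using inj that by (auto simp: inj_on_def)
  have crd: "card (f ` C) = card C" if "C \<subseteq> N" for C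
    using inj that by (metis card_image inj_on_subset)
  show ?thesis
  proof
    have "inj_on f (\<Union>P)" using inj part by (simp add: partition_on_def)
    then show "partition_on N' ((`) f ` P)"
      using part img by (auto simp: partition_on_def disjoint_image)
  next
    fix S' assume S': "S' \<subseteq> N'"
    let ?S = "{x \<in> N. f x \<in> S'}"
    have S: "f ` ?S = S'" using S' img by auto
    have "winning N' v' S' \<longleftrightarrow> winning N v ?S" using f(2)[of ?S] S by auto
    also have "\<dots> \<longleftrightarrow> (\<forall>C\<in>P. m C \<le> card (?S \<inter> C))" by (rule winning_iff) auto
    also have "\<dots> \<longleftrightarrow> (\<forall>C\<in>P. m {x \<in> N. f x \<in> f ` C} \<le> card (S' \<inter> f ` C))"
    proof (rule ball_cong[OF refl])
      fix C assume C: "C \<in> P"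
      have "f ` (?S \<inter> C) = S' \<inter> f ` C" using block_subset[OF C] by auto
      then have "card (S' \<inter> f ` C) = card (?S \<inter> C)" using crd[of "?S \<inter> C"] by auto
      then show "m C \<le> card (?S \<inter> C) \<longleftrightarrow> m {x \<in> N. f x \<in> f ` C} \<le> card (S' \<inter> f ` C)"
        using pre[OF block_subset[OF C]] by simp
    qed
    finally show "winning N' v' S' \<longleftrightarrow> (\<forall>D\<in>(`) f ` P. m {x \<in> N. f x \<in> D} \<le> card (S' \<inter> D))"
      by simp
  next
    fix D assume "D \<in> (`) f ` P"
    then show "m {x \<in> N. f x \<in> D} \<le> card D"
      using pre crd block_subset quota_le by auto
  next
    fix D E assume "D \<in> (`) f ` P" "E \<in> (`) f ` P"
    then obtain C C' where C: "C \<in> P" "D = f ` C" "C' \<in> P" "E = f ` C'" by auto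
    show "D = E" if "m {x \<in> N. f x \<in> D} = 0" "m {x \<in> N. f x \<in> E} = 0"
      using null_unique[of C C'] that C by (simp add: pre block_subset)
    show "D = E" if "m {x \<in> N. f x \<in> D} = card D" "m {x \<in> N. f x \<in> E} = card E"
      using veto_unique[of C C'] that C by (simp add: pre crd block_subset)
  qed (rule game')
qed

text \<open>The transported blocks form a reduced presentation of the second game, hence are its
  equivalence classes.\<close>

lemma isomorphic_imp_profile_eq:
  assumes "reduced_quota_game N v P m" and "simple_game N' v'" and "isomorphic_games N v N' v'"
  shows "profile N v = profile N' v'"
proof -
  obtain f where f: "bij_betw f N N'" "\<And>S. S \<subseteq> N \<Longrightarrow> winning N v S \<longleftrightarrow> winning N' v' (f ` S)"
    using assms(3) unfolding isomorphic_games_def by blast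
  interpret reduced_quota_game N v P m by fact
  interpret R: reduced_quota_game N' v' "(`) f ` P" "\<lambda>D. m {x \<in> N. f x \<in> D}"
    using isomorphic_transfers_quotas[OF assms(1,2) f] .
  have inj: "inj_on f N" using f by (auto simp: bij_betw_def)
  have "inj_on ((`) f) P"
    using inj_on_image[of f P] inj part by (simp add: partition_on_def)
  then have "profile N' v' = image_mset (\<lambda>C. (card (f ` C), m {x \<in> N. f x \<in> f ` C})) (mset_set P)"
    unfolding R.profile_eq by (simp add: image_mset_mset_set[symmetric] multiset.map_comp o_def)
  also have "\<dots> = profile N v"
    unfolding profile_eq
  proof (rule image_mset_cong)
    fix C assume "C \<in># mset_set P"
    then have C: "C \<subseteq> N" using finite_partition block_subset by simp
    have "card (f ` C) = card C" using inj C by (metis card_image inj_on_subset)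
    moreover have "{x \<in> N. f x \<in> f ` C} = C" using inj C by (auto simp: inj_on_def)
    ultimately show "(card (f ` C), m {x \<in> N. f x \<in> f ` C}) = (card C, m C)" by simp
  qed
  finally show ?thesis by simp
qed

lemma image_mset_mset_set_eq_imp_bij:
  assumes "finite A" "finite B" "image_mset f (mset_set A) = image_mset g (mset_set B)"
  obtains h where "bij_betw h A B" "\<And>a. a \<in> A \<Longrightarrow> g (h a) = f a"
proof -
  have "\<exists>h. bij_betw h A B \<and> (\<forall>a\<in>A. g (h a) = f a)"
    using assms
  proof (induction A arbitrary: B rule: finite_induct)
    case empty
    then have "B = {}" by (simp add: mset_set_empty_iff)
    then show ?case by (intro exI[of _ undefined]) (simp add: bij_betw_def)
  next
    case (insert a A)
    have "f a \<in># image_mset g (mset_set B)"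
      unfolding insert.prems(2)[symmetric] using insert.hyps by simp
    then obtain b where b: "b \<in> B" "g b = f a" using insert.prems by auto
    have "image_mset g (mset_set B) = add_mset (f a) (image_mset g (mset_set (B - {b})))"
      using mset_set.remove[OF insert.prems(1) b(1)] b by simp
    then have "image_mset f (mset_set A) = image_mset g (mset_set (B - {b}))"
      using insert by simp
    then obtain h where h: "bij_betw h A (B - {b})" "\<forall>x\<in>A. g (h x) = f x"
      using insert.IH[of "B - {b}"] insert.prems by auto
    have "bij_betw (h(a := b)) A (B - {b})"
      using h insert.hyps by (subst bij_betw_cong[of _ _ h]) auto
    then have "bij_betw (h(a := b)) (insert a A) (insert b (B - {b}))"
      using notIn_Un_bij_betw[of a A "h(a := b)" "B - {b}"] insert.hyps by simp
    then have "bij_betw (h(a := b)) (insert a A) B" using b by (simp add: insert_absorb)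
    moreover have "\<forall>x\<in>insert a A. g ((h(a := b)) x) = f x" using h b insert.hyps by auto
    ultimately show ?case by blast
  qed
  then show thesis using that by blast
qed

text \<open>Equal profiles match the classes by a bijection \<open>h\<close> that preserves sizes and quotas; gluing
  bijections between matching classes gives the isomorphism.\<close>

lemma profile_eq_imp_isomorphic:
  assumes "reduced_quota_game N v P m" and "reduced_quota_game N' v' P' m'"
    and eq: "profile N v = profile N' v'"
  shows "isomorphic_games N v N' v'"
proof -
  interpret reduced_quota_game N v P m by fact
  interpret R: reduced_quota_game N' v' P' m' by fact
  obtain h where h: "bij_betw h P P'" "\<And>C. C \<in> P \<Longrightarrow> (card (h C), m' (h C)) = (card C, m C)"
    by (rule image_mset_mset_set_eq_imp_bij[OF finite_partition R.finite_partition
          eq[unfolded profile_eq R.profile_eq]]) (rule that)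
  have hP: "h C \<in> P'" if "C \<in> P" for C using h that by (auto simp: bij_betw_def)
  have "\<forall>C\<in>P. \<exists>\<phi>. bij_betw \<phi> C (h C)"
    using h(2) hP finite_block R.finite_block by (auto intro!: finite_same_card_bij)
  then obtain \<phi> where \<phi>: "\<And>C. C \<in> P \<Longrightarrow> bij_betw (\<phi> C) C (h C)" by metis
  define f where "f x = \<phi> (THE C. C \<in> P \<and> x \<in> C) x" for x
  have f_eq: "f x = \<phi> C x" if "C \<in> P" "x \<in> C" for C x
  proof -
    have "(THE C. C \<in> P \<and> x \<in> C) = C" using that block_unique by (intro the_equality) auto
    then show ?thesis by (simp add: f_def)
  qed
  have f_block: "bij_betw f C (h C)" if "C \<in> P" for C
    using \<phi>[OF that] f_eq[OF that] by (subst bij_betw_cong) auto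
  have f_in: "f x \<in> h C \<longleftrightarrow> x \<in> C" if Cx: "C \<in> P" "x \<in> N" for C x
  proof
    assume fx: "f x \<in> h C"
    obtain D where D: "D \<in> P" "x \<in> D" using block_of Cx(2) by blast
    have "f x \<in> h D" using f_block[OF D(1)] D by (auto simp: bij_betw_def)
    then have "h D = h C" using R.block_unique fx hP D that by blast
    then have "D = C" using h(1) D that by (auto simp: bij_betw_def inj_on_def)
    then show "x \<in> C" using D by simp
  next
    assume "x \<in> C"
    then show "f x \<in> h C" using f_block that by (auto simp: bij_betw_def)
  qed
  have "disjoint_family_on h P"
    using h(1) hP R.disjoint_blocks unfolding disjoint_family_on_def bij_betw_def inj_on_def
    by metis
  then have "bij_betw f (\<Union>C\<in>P. C) (\<Union>C\<in>P. h C)"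
    by (rule bij_betw_UNION_disjoint) (rule f_block)
  moreover have "(\<Union>C\<in>P. C) = N" "(\<Union>C\<in>P. h C) = N'"
    using part R.part h(1) by (auto simp: partition_on_def bij_betw_def)
  ultimately have bij: "bij_betw f N N'" by simp
  have "winning N v S \<longleftrightarrow> winning N' v' (f ` S)" if S: "S \<subseteq> N" for S
  proof -
    have card_eq: "card (f ` S \<inter> h C) = card (S \<inter> C)" if C: "C \<in> P" for C
    proof -
      have "f ` S \<inter> h C = f ` (S \<inter> C)" using f_in[OF C] S by auto
      moreover have "inj_on f (S \<inter> C)" using bij S by (auto simp: bij_betw_def inj_on_def)
      ultimately show ?thesis by (simp add: card_image)
    qed
    have "f ` S \<subseteq> N'" using bij S by (auto simp: bij_betw_def)
    then have "winning N' v' (f ` S) \<longleftrightarrow> (\<forall>D\<in>h ` P. m' D \<le> card (f ` S \<inter> D))"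
      using R.winning_iff h(1) by (simp add: bij_betw_def)
    also have "\<dots> \<longleftrightarrow> winning N v S" using card_eq h(2) winning_iff[OF S] by simp
    finally show ?thesis by simp
  qed
  then show ?thesis using bij unfolding isomorphic_games_def by blast
qed

lemma game_iso_equiv: "equiv {(N, v). simple_game N v} game_iso"
proof (rule equivI)
  show "game_iso \<subseteq> {(N, v). simple_game N v} \<times> {(N, v). simple_game N v}"
    by (auto simp: game_iso_def)
  have "isomorphic_games N v N v" for N :: "nat set" and v
    unfolding isomorphic_games_def by (rule exI[of _ id]) auto
  then show "refl_on {(N, v). simple_game N v} game_iso"
    by (auto simp: refl_on_def game_iso_def)
  have "isomorphic_games N' v' N v" if iso: "isomorphic_games N v N' v'" for N N' :: "nat set" and v v'
  proof -
    obtain f where f: "bij_betw f N N'" "\<And>S. S \<subseteq> N \<Longrightarrow> winning N v S \<longleftrightarrow> winning N' v' (f ` S)"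
      using iso unfolding isomorphic_games_def by blast
    have "winning N' v' S \<longleftrightarrow> winning N v (inv_into N f ` S)" if "S \<subseteq> N'" for S
    proof -
      have "inv_into N f ` S \<subseteq> N" "f ` inv_into N f ` S = S"
        using f that by (auto simp: bij_betw_def image_inv_into_cancel inv_into_into)
      then show ?thesis using f(2) by metis
    qed
    then show ?thesis
      using bij_betw_inv_into[OF f(1)] unfolding isomorphic_games_def by blast
  qed
  then show "sym game_iso" by (auto simp: sym_def game_iso_def)
  have "isomorphic_games N v N'' v''"
    if iso: "isomorphic_games N v N' v'" "isomorphic_games N' v' N'' v''"
    for N N' N'' :: "nat set" and v v' v''
  proof -
    obtain f where f: "bij_betw f N N'" "\<And>S. S \<subseteq> N \<Longrightarrow> winning N v S \<longleftrightarrow> winning N' v' (f ` S)"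
      using iso(1) unfolding isomorphic_games_def by blast
    obtain g where g: "bij_betw g N' N''" "\<And>S. S \<subseteq> N' \<Longrightarrow> winning N' v' S \<longleftrightarrow> winning N'' v'' (g ` S)"
      using iso(2) unfolding isomorphic_games_def by blast
    have "winning N v S \<longleftrightarrow> winning N'' v'' ((g \<circ> f) ` S)" if S: "S \<subseteq> N" for S
    proof -
      have "f ` S \<subseteq> N'" using f(1) S by (auto simp: bij_betw_def)
      then show ?thesis using f(2)[OF S] g(2) by (simp add: image_comp)
    qed
    then show ?thesis
      using bij_betw_trans[OF f(1) g(1)] unfolding isomorphic_games_def by blast
  qed
  then show "trans game_iso" unfolding trans_def game_iso_def by blast
qed

text \<open>On \<open>X\<close> the function \<open>g\<close> is a complete invariant, so each value stands for exactly one class.\<close>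

lemma card_quotient_eq_card_image:
  assumes "equiv U r" "X \<subseteq> U" "\<And>x y. x \<in> X \<Longrightarrow> y \<in> X \<Longrightarrow> (x, y) \<in> r \<longleftrightarrow> g x = g y"
  shows "card (X // r) = card (g ` X)"
proof -
  have *: "r `` {x} = r `` {y} \<longleftrightarrow> g x = g y" if "x \<in> X" "y \<in> X" for x y
    using eq_equiv_class_iff[OF assms(1)] assms(2,3) that by blast
  have "bij_betw (\<lambda>x. r `` {inv_into X g x}) (g ` X) (X // r)"
    unfolding bij_betw_def
  proof
    show "inj_on (\<lambda>x. r `` {inv_into X g x}) (g ` X)"
      by (rule inj_onI) (metis * f_inv_into_f inv_into_into)
    have "r `` {inv_into X g (g x)} = r `` {x}" if "x \<in> X" for x
      using * that by (metis f_inv_into_f imageI inv_into_into)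
    then show "(\<lambda>x. r `` {inv_into X g x}) ` g ` X = X // r"
      by (auto simp: quotient_def)
  qed
  then show ?thesis by (simp add: bij_betw_same_card)
qed

section \<open>Isomorphism classes as multisets of pairs\<close>

text \<open>The pairs are \<open>(size, quota)\<close>. The positive quota reflects that the empty coalition loses, and the
  last two conditions that all null players are equivalent, as are all veto players.\<close>

definition profiles :: "nat \<Rightarrow> nat \<Rightarrow> (nat \<times> nat) multiset set" where
  "profiles n t = {M. size M = t \<and> sum_mset (image_mset fst M) = n \<and>
     (\<forall>p\<in>#M. 0 < fst p \<and> snd p \<le> fst p) \<and> (\<exists>p\<in>#M. 0 < snd p) \<and>
     size {#p \<in># M. snd p = 0#} \<le> 1 \<and> size {#p \<in># M. snd p = fst p#} \<le> 1}"

definition strict_profiles :: "nat \<Rightarrow> nat \<Rightarrow> (nat \<times> nat) multiset set" where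
  "strict_profiles n t = {M. size M = t \<and> sum_mset (image_mset fst M) = n \<and>
     (\<forall>p\<in>#M. 0 < snd p \<and> snd p < fst p)}"

lemma size_filter_image_mset_set_le_1:
  assumes "finite P"
  shows "size {#p \<in># image_mset h (mset_set P). Q p#} \<le> 1 \<longleftrightarrow>
    (\<forall>C\<in>P. \<forall>D\<in>P. Q (h C) \<longrightarrow> Q (h D) \<longrightarrow> C = D)"
proof -
  have "size {#p \<in># image_mset h (mset_set P). Q p#} = card {C \<in> P. Q (h C)}"
    using assms by (simp add: filter_mset_image_mset filter_mset_mset_set)
  then show ?thesis using assms by (auto simp: card_le_Suc0_iff_eq)
qed

lemma (in reduced_quota_game) profile_in_profiles: "profile N v \<in> profiles (card N) (card P)"
proof -
  have "card N = (\<Sum>C\<in>P. card C)"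
    using product_partition[OF part] finite_block by simp
  then show ?thesis
    unfolding profiles_def mem_Collect_eq profile_eq size_filter_image_mset_set_le_1[OF finite_partition]
    using finite_partition card_block_pos quota_le some_positive_quota null_unique veto_unique
    by (auto simp: multiset.map_comp o_def sum_unfold_sum_mset)
qed

lemma profile_of_game:
  assumes "(N, v) \<in> games n t 1"
  obtains P m where "reduced_quota_game N v P m" "profile N v \<in> profiles n t"
proof -
  have g: "simple_game N v" "card N = n" "card (player_classes N v) = t"
    "card (minimal_winning_vectors N v) = 1"
    using assms by (auto simp: games_def)
  obtain m where m: "reduced_quota_game N v (player_classes N v) m"
    using one_vector_imp_reduced_quota_game g by metis
  then show thesis using that reduced_quota_game.profile_in_profiles[OF m] g by simp
qed

lemma partition_with_multiset:
  fixes M :: "(nat \<times> nat) multiset"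
  assumes "\<forall>p\<in>#M. 0 < fst p"
  shows "\<exists>N P m. finite (N :: nat set) \<and> partition_on N P \<and>
    image_mset (\<lambda>C. (card C, m C)) (mset_set P) = M"
  using assms
proof (induction M)
  case empty
  then show ?case by (intro exI[of _ "{}"]) (auto simp: partition_on_def)
next
  case (add p M)
  then obtain N :: "nat set" and P m where IH: "finite N" "partition_on N P"
    "image_mset (\<lambda>C. (card C, m C)) (mset_set P) = M"
    by auto
  obtain C where C: "finite C" "card C = fst p" "C \<subseteq> - N"
    using infinite_arbitrarily_large[of "- N" "fst p"] IH(1) by auto
  have "C \<noteq> {}" using C add.prems by auto
  have "C \<notin> P" using C \<open>C \<noteq> {}\<close> IH(2) by (auto simp: partition_on_def)
  have finP: "finite P" using finite_elements[OF IH(1,2)] .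
  have "partition_on (N \<union> C) (insert C P)"
    using IH(2) C \<open>C \<noteq> {}\<close> by (auto simp: partition_on_def disjoint_def)
  moreover have "image_mset (\<lambda>D. (card D, (m(C := snd p)) D)) (mset_set P) = M"
    unfolding IH(3)[symmetric] using \<open>C \<notin> P\<close> finP by (intro image_mset_cong) auto
  then have "image_mset (\<lambda>D. (card D, (m(C := snd p)) D)) (mset_set (insert C P)) = add_mset p M"
    using \<open>C \<notin> P\<close> finP C by simp
  moreover have "finite (N \<union> C)" using IH C by simp
  ultimately show ?case by blast
qed

text \<open>Quotas on disjoint blocks of the prescribed sizes define a game, and the conditions on \<open>M\<close> make the
  presentation reduced, so that the blocks are its equivalence classes.\<close>

lemma game_with_profile:
  assumes "M \<in> profiles n t"
  obtains N v where "(N, v) \<in> games n t 1" "profile N v = M"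
proof -
  have M: "size M = t" "sum_mset (image_mset fst M) = n" "\<forall>p\<in>#M. 0 < fst p"
    "\<forall>p\<in>#M. snd p \<le> fst p" "\<exists>p\<in>#M. 0 < snd p"
    "size {#p \<in># M. snd p = 0#} \<le> 1" "size {#p \<in># M. snd p = fst p#} \<le> 1"
    using assms by (auto simp: profiles_def)
  obtain N :: "nat set" and P m where P: "finite N" "partition_on N P"
    "image_mset (\<lambda>C. (card C, m C)) (mset_set P) = M"
    using partition_with_multiset[OF M(3)] by metis
  have finP: "finite P" using finite_elements[OF P(1,2)] .
  have finC: "finite C" if "C \<in> P" for C
    using P that by (metis Union_upper finite_subset partition_onD1)
  define v where "v S = (if \<forall>C\<in>P. m C \<le> card (S \<inter> C) then 1 else 0 :: nat)" for S
  have le: "m C \<le> card C" if "C \<in> P" for C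
    using M(4) that finP by (auto simp flip: P(3))
  obtain C where C: "C \<in> P" "0 < m C" using M(5) finP by (auto simp flip: P(3))
  have "N \<inter> D = D" if "D \<in> P" for D using P(2) that by (auto simp: partition_on_def)
  then have vN: "v N = 1" using le by (auto simp: v_def)
  have v0: "v {} = 0" using C by (auto simp: v_def)
  have mono: "v S \<le> v T" if "S \<subseteq> T" for S T
  proof -
    have "card (S \<inter> D) \<le> card (T \<inter> D)" if "D \<in> P" for D
      using \<open>S \<subseteq> T\<close> finC[OF that] by (intro card_mono) auto
    then show ?thesis by (fastforce simp: v_def intro: order_trans)
  qed
  have "N \<noteq> {}" using vN v0 by auto
  then have game: "simple_game N v"
    using vN v0 mono P(1) by (auto simp: simple_game_def v_def)
  interpret reduced_quota_game N v P m
  proof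
    show "winning N v S \<longleftrightarrow> (\<forall>C\<in>P. m C \<le> card (S \<inter> C))" if "S \<subseteq> N" for S
      using that by (auto simp: winning_def v_def)
  qed (use game P le M(6,7)[folded P(3), unfolded size_filter_image_mset_set_le_1[OF finP]] in auto)
  have "profile N v = M" using profile_eq P(3) by simp
  moreover have "card N = n" "card P = t"
    using profile_in_profiles M(1,2) \<open>profile N v = M\<close> by (auto simp: profiles_def)
  then have "(N, v) \<in> games n t 1"
    using game player_classes_eq one_minimal_winning_vector by (simp add: games_def)
  ultimately show thesis using that by blast
qed

lemma game_iso_iff_profile_eq:
  assumes "(N, v) \<in> games n t 1" "(N', v') \<in> games n' t' 1"
  shows "((N, v), (N', v')) \<in> game_iso \<longleftrightarrow> profile N v = profile N' v'"
proof -
  have g: "simple_game N v" "simple_game N' v'" using assms by (auto simp: games_def)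
  obtain P m where R: "reduced_quota_game N v P m" using profile_of_game assms(1) by metis
  obtain P' m' where R': "reduced_quota_game N' v' P' m'" using profile_of_game assms(2) by metis
  show ?thesis
    using g isomorphic_imp_profile_eq[OF R g(2)] profile_eq_imp_isomorphic[OF R R']
    by (auto simp: game_iso_def)
qed

lemma profile_image_games:
  "(\<lambda>(N, v). profile N v) ` {(N, v) \<in> games n t 1. Q (profile N v)} = {M \<in> profiles n t. Q M}"
proof (intro subset_antisym subsetI)
  fix M assume "M \<in> {M \<in> profiles n t. Q M}"
  then obtain N v where "(N, v) \<in> games n t 1" "profile N v = M" "Q M"
    using game_with_profile by blast
  then show "M \<in> (\<lambda>(N, v). profile N v) ` {(N, v) \<in> games n t 1. Q (profile N v)}"
    by (intro image_eqI[of _ _ "(N, v)"]) simp_all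
next
  fix M assume "M \<in> (\<lambda>(N, v). profile N v) ` {(N, v) \<in> games n t 1. Q (profile N v)}"
  then obtain N v where "(N, v) \<in> games n t 1" "Q M" "M = profile N v" by auto
  then show "M \<in> {M \<in> profiles n t. Q M}"
    using profile_of_game by (metis mem_Collect_eq)
qed

lemma SG_eq_card_profiles: "SG n t 1 = card (profiles n t)"
proof -
  have "SG n t 1 = card ((\<lambda>(N, v). profile N v) ` games n t 1)"
    unfolding SG_def
  proof (rule card_quotient_eq_card_image[OF game_iso_equiv])
    show "games n t 1 \<subseteq> {(N, v). simple_game N v}" by (auto simp: games_def)
  qed (use game_iso_iff_profile_eq in auto)
  also have "(\<lambda>(N, v). profile N v) ` games n t 1 = profiles n t"
    using profile_image_games[where Q = "\<lambda>_. True"] by simp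
  finally show ?thesis .
qed

lemma (in reduced_quota_game) no_veto_no_null_iff:
  "(\<forall>a\<in>N. \<not> veto_player N v a \<and> \<not> null_player N v a) \<longleftrightarrow>
   (\<forall>p\<in>#profile N v. 0 < snd p \<and> snd p < fst p)"
proof -
  have "(\<forall>a\<in>N. \<not> veto_player N v a \<and> \<not> null_player N v a) \<longleftrightarrow>
    (\<forall>C\<in>P. \<forall>a\<in>C. \<not> veto_player N v a \<and> \<not> null_player N v a)"
    using part by (auto simp: partition_on_def)
  also have "\<dots> \<longleftrightarrow> (\<forall>C\<in>P. \<forall>a\<in>C. 0 < m C \<and> m C < card C)"
    using null_player_iff veto_player_iff quota_le by (metis le_neq_implies_less less_irrefl neq0_conv)
  also have "\<dots> \<longleftrightarrow> (\<forall>C\<in>P. 0 < m C \<and> m C < card C)"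
    using part by (auto simp: partition_on_def)
  finally show ?thesis using finite_partition by (simp add: profile_eq)
qed

lemma strict_profiles_eq:
  assumes "0 < t"
  shows "strict_profiles n t = {M \<in> profiles n t. \<forall>p\<in>#M. 0 < snd p \<and> snd p < fst p}"
proof -
  have "M \<in> profiles n t" if M: "M \<in> strict_profiles n t" for M
  proof -
    have s: "\<forall>p\<in>#M. 0 < snd p \<and> snd p < fst p" using M by (simp add: strict_profiles_def)
    have "M \<noteq> {#}" using M assms by (auto simp: strict_profiles_def)
    then have "\<exists>p\<in>#M. 0 < snd p" using s by fastforce
    moreover have "{#p \<in># M. snd p = 0#} = {#}" "{#p \<in># M. snd p = fst p#} = {#}"
      using s by auto
    moreover have "\<forall>p\<in>#M. 0 < fst p \<and> snd p \<le> fst p" using s by fastforce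
    ultimately show ?thesis
      using M by (simp add: strict_profiles_def profiles_def del: filter_mset_eq_mempty_iff)
  qed
  then show ?thesis by (auto simp: strict_profiles_def profiles_def)
qed

lemma SG_no_veto_no_null_eq_card_strict_profiles:
  assumes "0 < t"
  shows "SG_no_veto_no_null n t 1 = card (strict_profiles n t)"
proof -
  let ?X = "{(N, v) \<in> games n t 1. \<forall>a\<in>N. \<not> veto_player N v a \<and> \<not> null_player N v a}"
  have X: "?X = {(N, v) \<in> games n t 1. \<forall>p\<in>#profile N v. 0 < snd p \<and> snd p < fst p}"
    using reduced_quota_game.no_veto_no_null_iff profile_of_game by (metis (no_types, lifting))
  have "SG_no_veto_no_null n t 1 = card ((\<lambda>(N, v). profile N v) ` ?X)"
    unfolding SG_no_veto_no_null_def
  proof (rule card_quotient_eq_card_image[OF game_iso_equiv])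
    show "?X \<subseteq> {(N, v). simple_game N v}" by (auto simp: games_def)
  qed (use game_iso_iff_profile_eq in auto)
  also have "(\<lambda>(N, v). profile N v) ` ?X = strict_profiles n t"
    unfolding X strict_profiles_eq[OF assms] by (rule profile_image_games)
  finally show ?thesis .
qed

section \<open>Counting profiles\<close>

text \<open>The families \<open>K n t\<close> are thought of as multisets of \<open>t\<close> pairs whose sizes add up to \<open>n\<close>; at most one
  further pair \<open>c i\<close> of size \<open>i\<close> is added.\<close>

definition adjoin ::
  "(nat \<Rightarrow> 'a) \<Rightarrow> (nat \<Rightarrow> nat \<Rightarrow> 'a multiset set) \<Rightarrow> nat \<Rightarrow> nat \<Rightarrow> 'a multiset set" where
  "adjoin c K n t = K n t \<union> (\<Union>i\<in>{1..n}. add_mset (c i) ` K (n - i) (t - 1))"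

text \<open>As \<open>c i\<close> does not occur in the multisets it is added to, its index can be read off from the result,
  which makes the union disjoint.\<close>

lemma card_adjoin:
  assumes fin: "\<And>n t. finite (K n t)"
    and new: "\<And>n t M i. M \<in> K n t \<Longrightarrow> 1 \<le> i \<Longrightarrow> c i \<notin># M"
    and inj: "inj c"
  shows "finite (adjoin c K n t)"
    and "card (adjoin c K n t) = card (K n t) + (\<Sum>i = 1..n. card (K (n - i) (t - 1)))"
proof -
  let ?A = "\<lambda>i. add_mset (c i) ` K (n - i) (t - 1)"
  show "finite (adjoin c K n t)" using fin by (auto simp: adjoin_def)
  have disj: "?A i \<inter> ?A j = {}" if ij: "i \<in> {1..n}" "j \<in> {1..n}" "i \<noteq> j" for i j
  proof -
    have "c i \<noteq> c j" using inj ij(3) by (simp add: inj_eq)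
    then have "add_mset (c i) A \<noteq> add_mset (c j) B" if "B \<in> K (n - j) (t - 1)" for A B
      using new[OF that, of i] ij(1) by (auto simp: add_eq_conv_ex)
    then show ?thesis by blast
  qed
  have "K n t \<inter> (\<Union>i\<in>{1..n}. ?A i) = {}"
    using new[of _ n t] by fastforce
  then have "card (adjoin c K n t) = card (K n t) + card (\<Union>i\<in>{1..n}. ?A i)"
    unfolding adjoin_def using fin by (intro card_Un_disjoint) auto
  also have "card (\<Union>i\<in>{1..n}. ?A i) = (\<Sum>i = 1..n. card (?A i))"
    using fin disj by (intro card_UN_disjoint) auto
  also have "\<dots> = (\<Sum>i = 1..n. card (K (n - i) (t - 1)))"
    by (intro sum.cong refl card_image) (simp add: inj_on_def)
  finally show "card (adjoin c K n t) = card (K n t) + (\<Sum>i = 1..n. card (K (n - i) (t - 1)))" .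
qed

text \<open>The set \<open>c ` {1..}\<close> is the kind of pair being adjoined, and \<open>R\<close> is a condition that pairs of this
  kind do not affect. Removing the pair of this kind, if there is one, inverts the adjunction.\<close>

lemma adjoin_eq:
  fixes c :: "nat \<Rightarrow> nat \<times> nat"
  assumes fst_c: "\<And>i. fst (c i) = i" and t: "1 \<le> t"
    and K: "\<And>s m. s \<in> {t, t - 1} \<Longrightarrow> K m s = {M. size M = s \<and> sum_mset (image_mset fst M) = m \<and>
              R M \<and> (\<forall>p\<in>#M. p \<notin> c ` {1..})}"
    and R: "\<And>i M. 1 \<le> i \<Longrightarrow> R (add_mset (c i) M) \<longleftrightarrow> R M"
  shows "adjoin c K n t = {M. size M = t \<and> sum_mset (image_mset fst M) = n \<and>
              R M \<and> size {#p \<in># M. p \<in> c ` {1..}#} \<le> 1}"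
    (is "_ = ?rhs")
proof (intro subset_antisym subsetI)
  fix M assume "M \<in> adjoin c K n t"
  then consider "M \<in> K n t"
    | i M' where "1 \<le> i" "i \<le> n" "M' \<in> K (n - i) (t - 1)" "M = add_mset (c i) M'"
    by (auto simp: adjoin_def)
  then show "M \<in> ?rhs"
  proof cases
    case 1
    then have "{#p \<in># M. p \<in> c ` {1..}#} = {#}" by (auto simp: K)
    then show ?thesis using 1 by (simp add: K del: filter_mset_eq_mempty_iff)
  next
    case 2
    then have "{#p \<in># M'. p \<in> c ` {1..}#} = {#}" by (auto simp: K)
    then show ?thesis using 2 t R fst_c by (simp add: K del: filter_mset_eq_mempty_iff)
  qed
next
  fix M assume M: "M \<in> ?rhs"
  show "M \<in> adjoin c K n t"
  proof (cases "size {#p \<in># M. p \<in> c ` {1..}#}")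
    case 0
    then have "M \<in> K n t" using M by (auto simp: K)
    then show ?thesis by (simp add: adjoin_def)
  next
    case (Suc k)
    then have "size {#p \<in># M. p \<in> c ` {1..}#} = 1" using M by simp
    then obtain q where q: "{#p \<in># M. p \<in> c ` {1..}#} = {#q#}"
      using size_1_singleton_mset by blast
    then have "q \<in># {#p \<in># M. p \<in> c ` {1..}#}" by simp
    then obtain i where i: "q = c i" "1 \<le> i" "q \<in># M" by auto
    obtain M' where M': "M = add_mset (c i) M'" using i by (metis insert_DiffM)
    have "{#p \<in># M'. p \<in> c ` {1..}#} = {#}" using q M' i by simp
    then have "M' \<in> K (n - i) (t - 1)" using M M' R i(2) fst_c by (auto simp: K)
    moreover have "i \<le> n" using M M' fst_c by auto
    ultimately show ?thesis using i(2) M' by (auto simp: adjoin_def)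
  qed
qed

lemma finite_strict_profiles: "finite (strict_profiles n t)"
proof (rule finite_subset)
  have "p \<in> {..n} \<times> {..n}" if "M \<in> strict_profiles n t" "p \<in># M" for M p
  proof -
    obtain M' where "M = add_mset p M'" using \<open>p \<in># M\<close> by (metis insert_DiffM)
    then have "fst p \<le> n" "snd p < fst p" using that by (auto simp: strict_profiles_def)
    then show ?thesis by (cases p) simp
  qed
  then show "strict_profiles n t \<subseteq> multisets_of_size ({..n} \<times> {..n}) t"
    by (auto simp: multisets_of_size_def strict_profiles_def)
qed auto

text \<open>Null pairs are adjoined first and veto pairs second. A veto pair is then new to the multisets
  it is added to, and the bound on the number of null pairs is a condition that veto pairs do not
  affect.\<close>

lemma profiles_eq_adjoin:
  assumes "2 \<le> t"
  shows "profiles n t = adjoin (\<lambda>i. (i, i)) (adjoin (\<lambda>i. (i, 0)) strict_profiles) n t"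
proof -
  let ?null = "\<lambda>p. p \<in> (\<lambda>i::nat. (i, 0::nat)) ` {1..}"
  let ?veto = "\<lambda>p. p \<in> (\<lambda>i::nat. (i, i)) ` {1..}"
  let ?strict = "\<lambda>p::nat \<times> nat. 0 < snd p \<and> snd p < fst p"
  let ?R0 = "\<lambda>M. \<forall>p\<in>#M. ?null p \<or> ?strict p"
  let ?R1 = "\<lambda>M. (\<forall>p\<in>#M. ?null p \<or> ?veto p \<or> ?strict p) \<and> size {#p \<in># M. ?null p#} \<le> 1"
  have kinds: "?null p \<longleftrightarrow> 0 < fst p \<and> snd p = 0" "?veto p \<longleftrightarrow> 0 < fst p \<and> snd p = fst p" for p
    by (cases p; auto simp: image_iff)+
  have null: "adjoin (\<lambda>i. (i, 0)) strict_profiles m s =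
      {M. size M = s \<and> sum_mset (image_mset fst M) = m \<and> ?R0 M \<and> size {#p \<in># M. ?null p#} \<le> 1}"
    if "1 \<le> s" for m s
  proof (rule adjoin_eq[OF _ that])
    fix s' m'
    show "strict_profiles m' s' =
      {M. size M = s' \<and> sum_mset (image_mset fst M) = m' \<and> ?R0 M \<and> (\<forall>p\<in>#M. \<not> ?null p)}"
      unfolding strict_profiles_def kinds by (intro Collect_cong) fastforce
  qed auto
  have "adjoin (\<lambda>i. (i, i)) (adjoin (\<lambda>i. (i, 0)) strict_profiles) n t =
      {M. size M = t \<and> sum_mset (image_mset fst M) = n \<and> ?R1 M \<and> size {#p \<in># M. ?veto p#} \<le> 1}"
  proof (rule adjoin_eq)
    fix s m assume "s \<in> {t, t - 1}"
    then have "1 \<le> s" using assms by auto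
    have "?R0 M \<longleftrightarrow> (\<forall>p\<in>#M. ?null p \<or> ?veto p \<or> ?strict p) \<and> (\<forall>p\<in>#M. \<not> ?veto p)" for M
      unfolding kinds by (auto; fastforce)
    then show "adjoin (\<lambda>i. (i, 0)) strict_profiles m s =
      {M. size M = s \<and> sum_mset (image_mset fst M) = m \<and> ?R1 M \<and> (\<forall>p\<in>#M. \<not> ?veto p)}"
      unfolding null[OF \<open>1 \<le> s\<close>] by (intro Collect_cong) blast
  qed (use assms in auto)
  also have "\<dots> = profiles n t"
  proof -
    have all: "(\<forall>p\<in>#M. ?null p \<or> ?veto p \<or> ?strict p) \<longleftrightarrow> (\<forall>p\<in>#M. 0 < fst p \<and> snd p \<le> fst p)"
      for M unfolding kinds by (intro ball_cong) auto
    have filters: "{#p \<in># M. ?null p#} = {#p \<in># M. snd p = 0#}"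
      "{#p \<in># M. ?veto p#} = {#p \<in># M. snd p = fst p#}"
      if "\<forall>p\<in>#M. 0 < fst p \<and> snd p \<le> fst p" for M
      unfolding kinds using that by (auto intro!: filter_mset_cong)
    \<comment> \<open>A profile has at most one pair with quota \<open>0\<close>, so two pairs force a positive quota.\<close>
    have pos: "\<exists>p\<in>#M. 0 < snd p" if "size M = t" "size {#p \<in># M. snd p = 0#} \<le> 1"
      for M :: "(nat \<times> nat) multiset"
    proof (rule ccontr)
      assume "\<not> ?thesis"
      then have "{#p \<in># M. snd p = 0#} = M" by (simp add: filter_mset_eq_conv)
      then show False using that assms by simp
    qed
    have "?R1 M \<and> size {#p \<in># M. ?veto p#} \<le> 1 \<longleftrightarrow>
        (\<forall>p\<in>#M. 0 < fst p \<and> snd p \<le> fst p) \<and> (\<exists>p\<in>#M. 0 < snd p) \<and>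
        size {#p \<in># M. snd p = 0#} \<le> 1 \<and> size {#p \<in># M. snd p = fst p#} \<le> 1"
      if "size M = t" for M
    proof (cases "\<forall>p\<in>#M. 0 < fst p \<and> snd p \<le> fst p")
      case True
      show ?thesis unfolding all filters[OF True] using True pos[OF that] by blast
    next
      case False
      then show ?thesis unfolding all by blast
    qed
    then show ?thesis unfolding profiles_def by (intro Collect_cong) blast
  qed
  finally show ?thesis by simp
qed

lemma sum_reverse: "(\<Sum>i = 1..n. g (n - i)) = (\<Sum>j<n. g j)" for g :: "nat \<Rightarrow> nat"
  by (simp add: sum.atLeast1_atMost_eq sum.nat_diff_reindex)

text \<open>Both sides count \<open>g j\<close> once for every way to write \<open>n - j\<close> as a sum of two positive integers, of
  which there are \<open>n - j - 1\<close>.\<close>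

lemma sum_triangle:
  "(\<Sum>i = 1..n. \<Sum>j = 1..n - i. g (n - i - j)) = (\<Sum>s = 2..n. (s - 1) * g (n - s))"
  for g :: "nat \<Rightarrow> nat"
proof -
  have "(\<Sum>i = 1..n. \<Sum>j = 1..n - i. g (n - i - j)) = (\<Sum>k<n. \<Sum>j<k. g j)"
    unfolding sum_reverse by (rule sum_reverse)
  also have "\<dots> = (\<Sum>j<n. (n - j - 1) * g j)"
  proof (induction n)
    case (Suc n)
    have "(\<Sum>j<n. (n - j) * g j) = (\<Sum>j<n. (n - j - 1) * g j + g j)"
    proof (rule sum.cong[OF refl])
      fix j assume "j \<in> {..<n}"
      then have "n - j = Suc (n - j - 1)" by simp
      then show "(n - j) * g j = (n - j - 1) * g j + g j"
        by (metis add.commute mult_Suc)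
    qed
    then show ?case using Suc by (simp add: sum.distrib)
  qed simp
  also have "\<dots> = (\<Sum>s = 1..n. (s - 1) * g (n - s))"
    unfolding sum_reverse[of "\<lambda>j. (n - j - 1) * g j" n, symmetric] by (intro sum.cong) auto
  also have "\<dots> = (\<Sum>s = 2..n. (s - 1) * g (n - s))"
    by (rule sum.mono_neutral_right) auto
  finally show ?thesis .
qed

lemma card_profiles:
  assumes "2 \<le> t"
  shows "card (profiles n t) = card (strict_profiles n t)
    + 2 * (\<Sum>i = 1..n. card (strict_profiles (n - i) (t - 1)))
    + (\<Sum>s = 2..n. (s - 1) * card (strict_profiles (n - s) (t - 2)))"
proof -
  let ?S = strict_profiles and ?T = "adjoin (\<lambda>i. (i, 0)) strict_profiles"
  have no_null: "(i, 0) \<notin># M" if "M \<in> ?S n t" for i M n t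
    using that by (auto simp: strict_profiles_def)
  have S: "finite (?T n t)"
    "card (?T n t) = card (?S n t) + (\<Sum>i = 1..n. card (?S (n - i) (t - 1)))" for n t
    using card_adjoin[of strict_profiles "\<lambda>i. (i, 0)" n t]
    by (auto simp: finite_strict_profiles inj_on_def dest: no_null)
  have new: "(i, i) \<notin># M" if "M \<in> ?T n t" "1 \<le> i" for i M n t
    using that by (fastforce simp: adjoin_def strict_profiles_def)
  have "card (profiles n t) = card (?T n t) + (\<Sum>i = 1..n. card (?T (n - i) (t - 1)))"
    unfolding profiles_eq_adjoin[OF assms]
    by (rule card_adjoin) (auto simp: S(1) new inj_on_def)
  also have "\<dots> = card (?S n t) + 2 * (\<Sum>i = 1..n. card (?S (n - i) (t - 1)))
      + (\<Sum>i = 1..n. \<Sum>j = 1..n - i. card (?S (n - i - j) (t - 2)))"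
    by (simp add: S(2) sum.distrib numeral_2_eq_2)
  also have "(\<Sum>i = 1..n. \<Sum>j = 1..n - i. card (?S (n - i - j) (t - 2)))
      = (\<Sum>s = 2..n. (s - 1) * card (?S (n - s) (t - 2)))"
    by (rule sum_triangle)
  finally show ?thesis .
qed

text \<open>A quota strictly between \<open>0\<close> and the size forces a size of at least \<open>2\<close>.\<close>

lemma strict_profiles_empty:
  assumes "0 < t" "m < 2"
  shows "strict_profiles m t = {}"
proof -
  have False if M: "M \<in> strict_profiles m t" for M
  proof -
    have "M \<noteq> {#}" using M assms by (auto simp: strict_profiles_def)
    then obtain p M' where "M = add_mset p M'" by (metis multiset_cases)
    then show False using M assms by (auto simp: strict_profiles_def)
  qed
  then show ?thesis by blast
qed

lemma strict_profiles_0: "strict_profiles m 0 = (if m = 0 then {{#}} else {})"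
  by (auto simp: strict_profiles_def)

lemma sum_strict_profiles_trim:
  assumes "0 < t"
  shows "(\<Sum>i = a..n. h i * card (strict_profiles (n - i) t))
    = (\<Sum>i = a..n - 2. h i * card (strict_profiles (n - i) t))"
  by (rule sum.mono_neutral_right) (use assms in \<open>auto simp: strict_profiles_empty\<close>)

theorem theorem3p14:
  fixes n :: nat
  assumes "n \<ge> 1"
  shows "(\<forall>t::nat. t > 2 \<longrightarrow>
            SG n t 1 = SG_no_veto_no_null n t 1
              + 2 * (\<Sum>i = 1..n - 2. SG_no_veto_no_null (n - i) (t - 1) 1)
              + (\<Sum>i = 2..n - 2. (i - 1) * SG_no_veto_no_null (n - i) (t - 2) 1))
       \<and> SG n 2 1 = SG_no_veto_no_null n 2 1
              + 2 * (\<Sum>i = 1..n - 2. SG_no_veto_no_null (n - i) 1 1)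
              + (n - 1)"
proof -
  have trim: "(\<Sum>i = a..n. h i * card (strict_profiles (n - i) s))
      = (\<Sum>i = a..n - 2. h i * SG_no_veto_no_null (n - i) s 1)" if "0 < s" for a h s
    unfolding sum_strict_profiles_trim[OF that] SG_no_veto_no_null_eq_card_strict_profiles[OF that]
    by (rule refl)
  have count: "SG n t 1 = SG_no_veto_no_null n t 1
      + 2 * (\<Sum>i = 1..n - 2. SG_no_veto_no_null (n - i) (t - 1) 1)
      + (\<Sum>s = 2..n. (s - 1) * card (strict_profiles (n - s) (t - 2)))" if "2 \<le> t" for t
    using that card_profiles[OF that, of n] trim[of "t - 1" "\<lambda>_. 1" 1]
      SG_eq_card_profiles[of n t] SG_no_veto_no_null_eq_card_strict_profiles[of t n] by simp
  \<comment> \<open>Only the empty profile has no pairs, and it has size \<open>0\<close>: the term \<open>s = n\<close> survives.\<close>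
  have "(\<Sum>s = 2..n. (s - 1) * card (strict_profiles (n - s) 0))
      = (\<Sum>s\<in>{2..n} \<inter> {n}. (s - 1) * 1)"
    by (rule sum.mono_neutral_cong_right) (auto simp: strict_profiles_0)
  also have "\<dots> = n - 1" using assms by (cases "n = 1") auto
  finally have both: "(\<Sum>s = 2..n. (s - 1) * card (strict_profiles (n - s) 0)) = n - 1" .
  have "SG n t 1 = SG_no_veto_no_null n t 1
      + 2 * (\<Sum>i = 1..n - 2. SG_no_veto_no_null (n - i) (t - 1) 1)
      + (\<Sum>i = 2..n - 2. (i - 1) * SG_no_veto_no_null (n - i) (t - 2) 1)"
    if "2 < t" for t
    using that count[of t] trim[of "t - 2" "\<lambda>i. i - 1" 2] by simp
  moreover have "SG n 2 1 = SG_no_veto_no_null n 2 1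
      + 2 * (\<Sum>i = 1..n - 2. SG_no_veto_no_null (n - i) 1 1) + (n - 1)"
    using count[of 2] both by simp
  ultimately show ?thesis by blast
qed

end
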